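(* Let $(\mathbb{R}^n,g)$ be a pseudo-Euclidean space, $n\ge3$, with coordinates $x=(x_1,\dots,x_n)$ and $g_{ij}=\delta_{ij}\varepsilon_i$, $1\le i,j\le n$, where $\varepsilon_i=\pm1$. Consider $\bar g=\frac{1}{\psi(r)^2}g$, where $r=\sum_{k=1}^n\varepsilon_kx_k^2$. Then $\bar g$ has scalar curvature $K_{\bar g}=0$ if and only if $$\psi(r)=\frac{k_2\,r}{\left(1+Ar^{\frac{n-2}{2}}\right)^{\frac{2}{n-2}}},$$ where $A,k_2\in\mathbb{R}$ with $k_2>0$. If $A\ge0$, the metric $\bar g$ is defined in $\mathbb{R}^n\setminus\{0\}$. If $A<0$, the set of singularity points of $\bar g$ consists of the origin and an $(n-1)$-dimensional sphere with center at the origin and radius $R=\sqrt{\left(\frac{-1}{A}\right)^{\frac{2}{n-2}}}$.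
   Context: $K_{\bar g}$ denotes the scalar curvature of $\bar g$. The notation $\psi(r)$ means that the conformal factor depends on $x$ only through $r$.
   Formalization: ψ is taken smooth, positive and nonconstant (constant ψ is flat) on an open interval of r-values; r and 1+Ar^((n-2)/2) are read in absolute value; for indefinite g, the origin is replaced by r=0 and the sphere by |r|=R²; the literal last two sentences are stated for definite g. *)

theory Defs
  imports "HOL-Analysis.Analysis"
begin

text \<open>
  Curvature in coordinates. A (pseudo-Riemannian) metric on an open subset of $R^n$ is
  represented by the field \<open>h\<close> of its Gram matrices in the standard coordinates; only its values
  on the open set matter.
\<close>

definition pd :: "'a::real_normed_vector \<Rightarrow> ('a \<Rightarrow> real) \<Rightarrow> 'a \<Rightarrow> real" where
  "pd v f x = frechet_derivative f (at x) v"

abbreviation pdi :: "'n::finite \<Rightarrow> (real^'n \<Rightarrow> real) \<Rightarrow> real^'n \<Rightarrow> real" where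
  "pdi i \<equiv> pd (axis i 1)"

text \<open>On open sets: all iterated partial derivatives up to order \<open>k\<close> exist and are continuous.\<close>

fun Ck_on :: "nat \<Rightarrow> ('a::euclidean_space) set \<Rightarrow> ('a \<Rightarrow> real) \<Rightarrow> bool" where
  "Ck_on 0 S f \<longleftrightarrow> continuous_on S f"
| "Ck_on (Suc k) S f \<longleftrightarrow> f differentiable_on S \<and> (\<forall>b\<in>Basis. Ck_on k S (pd b f))"

definition smooth_on :: "('a::euclidean_space) set \<Rightarrow> ('a \<Rightarrow> real) \<Rightarrow> bool" where
  "smooth_on S f \<longleftrightarrow> (\<forall>k. Ck_on k S f)"

definition pseudo_metric_on :: "(real^'n) set \<Rightarrow> (real^'n \<Rightarrow> real^'n^'n::finite) \<Rightarrow> bool" where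
  "pseudo_metric_on S h \<longleftrightarrow> open S \<and>
     (\<forall>i j. smooth_on S (\<lambda>x. h x $ i $ j)) \<and>
     (\<forall>x\<in>S. transpose (h x) = h x \<and> det (h x) \<noteq> 0)"

definition christoffel :: "(real^'n \<Rightarrow> real^'n^'n::finite) \<Rightarrow> 'n \<Rightarrow> 'n \<Rightarrow> 'n \<Rightarrow> real^'n \<Rightarrow> real" where
  "christoffel h k i j x =
     (\<Sum>l\<in>UNIV. matrix_inv (h x) $ k $ l *
        (pdi i (\<lambda>y. h y $ j $ l) x + pdi j (\<lambda>y. h y $ i $ l) x - pdi l (\<lambda>y. h y $ i $ j) x)) / 2"

definition ricci :: "(real^'n \<Rightarrow> real^'n^'n::finite) \<Rightarrow> 'n \<Rightarrow> 'n \<Rightarrow> real^'n \<Rightarrow> real" where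
  "ricci h i j x =
     (\<Sum>k\<in>UNIV. pdi k (christoffel h k i j) x - pdi j (christoffel h k i k) x) +
     (\<Sum>k\<in>UNIV. \<Sum>l\<in>UNIV. christoffel h k k l x * christoffel h l i j x
                        - christoffel h k j l x * christoffel h l i k x)"

definition scalar_curvature :: "(real^'n \<Rightarrow> real^'n^'n::finite) \<Rightarrow> real^'n \<Rightarrow> real" where
  "scalar_curvature h x = (\<Sum>i\<in>UNIV. \<Sum>j\<in>UNIV. matrix_inv (h x) $ i $ j * ricci h i j x)"

text \<open>
  Singularity points of a metric \<open>h\<close> whose defining expression makes sense on the (dense) set \<open>D\<close>:
  the points near which there is no smooth nondegenerate metric agreeing with \<open>h\<close> on \<open>D\<close>. Values
  of \<open>h\<close> outside \<open>D\<close>, which may come from conventions such as \<open>a / 0 = 0\<close>, play no role.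
\<close>

definition singularity_points :: "(real^'n) set \<Rightarrow> (real^'n \<Rightarrow> real^'n^'n::finite) \<Rightarrow> (real^'n) set" where
  "singularity_points D h =
     {x. \<not> (\<exists>U h'. x \<in> U \<and> pseudo_metric_on U h' \<and> (\<forall>y\<in>U \<inter> D. h' y = h y))}"

definition pe_metric :: "('n::finite \<Rightarrow> real) \<Rightarrow> real^'n^'n" where
  "pe_metric \<epsilon> = (\<chi> i j. if i = j then \<epsilon> i else 0)"

definition pe_r :: "('n::finite \<Rightarrow> real) \<Rightarrow> real^'n \<Rightarrow> real" where
  "pe_r \<epsilon> x = (\<Sum>k\<in>UNIV. \<epsilon> k * (x $ k)\<^sup>2)"

definition conf_metric :: "('n::finite \<Rightarrow> real) \<Rightarrow> (real \<Rightarrow> real) \<Rightarrow> real^'n \<Rightarrow> real^'n^'n" where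
  "conf_metric \<epsilon> \<psi> x = (1 / (\<psi> (pe_r \<epsilon> x))\<^sup>2) *\<^sub>R pe_metric \<epsilon>"

text \<open>
  The function $k_2 r / (1 + A r^{(n-2)/2})^{2/(n-2)}$. The conformal factor is normalised to be
  positive, and real powers of possibly negative bases are read through the absolute value; for
  $r > 0$ and $1 + A r^{(n-2)/2} > 0$ this is the displayed expression verbatim. (The absolute
  values are needed because $r$ takes negative values when some sign is $-1$, and because for
  $A < 0$ the metric is also considered where $1 + A r^{(n-2)/2} < 0$.)
\<close>

definition psi_sol :: "nat \<Rightarrow> real \<Rightarrow> real \<Rightarrow> real \<Rightarrow> real" where
  "psi_sol n A k\<^sub>2 r =
     k\<^sub>2 * \<bar>r\<bar> / \<bar>1 + A * \<bar>r\<bar> powr ((real n - 2) / 2)\<bar> powr (2 / (real n - 2))"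

text \<open>The values of \<open>r\<close> at which \<open>psi_sol n A k\<^sub>2\<close> is well defined and nonzero (for positive \<open>k\<^sub>2\<close>).\<close>

definition psi_dom :: "nat \<Rightarrow> real \<Rightarrow> real set" where
  "psi_dom n A = {r. r \<noteq> 0 \<and> 1 + A * \<bar>r\<bar> powr ((real n - 2) / 2) \<noteq> 0}"

definition sing_radius :: "nat \<Rightarrow> real \<Rightarrow> real" where
  "sing_radius n A = sqrt ((- 1 / A) powr (2 / (real n - 2)))"

end

theory Submission
  imports Defs
begin

text \<open>
  Put $m = (n-2)/2$ and $u = \psi^{-m}$, so that the conformal metric is $u^{2/m} g$. It is scalar
  flat iff $u(r)$ is annihilated by the flat wave operator $\sum_i \varepsilon_i \partial_i^2$, which on
  functions of $r$ is the Euler equation $r u'' + (m+1) u' = 0$. Its solutions on an interval avoiding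
  $0$ are $a + b |r|^{-m}$, and $b \neq 0$ because $\psi$ is not constant; taking the power $-1/m$
  gives the stated family. On an interval containing $0$ the quantity $r^n u'^2$ is constant, hence $0$, so
  there are only constant solutions. For the singular points with $A < 0$, a smooth extension $h$ of the
  metric would satisfy $k_2^2 r^2 h_{ij} = \delta_{ij} \varepsilon_i |1 + A |r|^m|^{2/m}$ by continuity,
  which is impossible where $r = 0$ and forces $h = 0$ where $1 + A |r|^m = 0$.
\<close>

subsection \<open>Iterated partial derivatives\<close>

lemma pd_eqI:
  assumes "(f has_derivative f') (at x)"
  shows "pd v f x = f' v"
  unfolding pd_def using frechet_derivative_at[OF assms] by simp

text \<open>\<open>frechet_derivative\<close> is a choice among all derivatives at a point. Locally
  equal functions have the same derivatives there, so the two choices coincide, also where neither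
  function is differentiable.\<close>

lemma pd_cong_open:
  assumes "open S" "x \<in> S" "\<And>y. y \<in> S \<Longrightarrow> f y = g y"
  shows "pd v f x = pd v g x"
proof -
  have "(f has_derivative D) (at x) \<longleftrightarrow> (g has_derivative D) (at x)" for D
    using has_derivative_transform_within_open[of f D x UNIV S g]
      has_derivative_transform_within_open[of g D x UNIV S f] assms by auto
  then show ?thesis
    by (simp add: pd_def frechet_derivative_def)
qed

lemma has_derivative_frechet_derivative:
  assumes "open S" "f differentiable_on S" "x \<in> S"
  shows "(f has_derivative (\<lambda>v. pd v f x)) (at x)"
  using assms unfolding pd_def differentiable_on_eq_differentiable_at[OF assms(1)]
  by (simp flip: frechet_derivative_works)

text \<open>The rules for sums, products and powers determine \<open>pd b\<close> only at points of
  S, so the closure properties below need a notion that ignores values elsewhere. Openness makes the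
  partial derivatives local.\<close>

lemma Ck_on_cong:
  assumes "open S" "\<And>y. y \<in> S \<Longrightarrow> f y = g y"
  shows "Ck_on k S f \<longleftrightarrow> Ck_on k S g"
  using assms(2)
proof (induction k arbitrary: f g)
  case 0
  then show ?case by (simp cong: continuous_on_cong)
next
  case (Suc k)
  have "f differentiable_on S \<longleftrightarrow> g differentiable_on S"
    using Suc.prems by (auto simp: differentiable_on_def
        intro: differentiable_transform_within[where d=1])
  moreover have "Ck_on k S (pd b f) \<longleftrightarrow> Ck_on k S (pd b g)" for b
    using Suc.prems by (intro Suc.IH pd_cong_open[OF assms(1)])
  ultimately show ?case by simp
qed

lemma Ck_on_SucD: "Ck_on (Suc k) S f \<Longrightarrow> Ck_on k S f"
  by (induction k arbitrary: f) (auto simp: differentiable_imp_continuous_on)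

lemma Ck_on_const: "Ck_on k S (\<lambda>x. c)"
proof (induction k arbitrary: c)
  case (Suc k)
  have "pd b (\<lambda>x::'a. c) = (\<lambda>x. 0)" for b
    by (rule ext, rule pd_eqI) (auto intro!: derivative_eq_intros)
  then show ?case using Suc by simp
qed simp

lemma Ck_on_linear:
  assumes "bounded_linear f"
  shows "Ck_on k S f"
proof (cases k)
  case 0
  then show ?thesis using assms by (simp add: linear_continuous_on)
next
  case (Suc m)
  have "pd b f = (\<lambda>x. f b)" for b
    by (rule ext, rule pd_eqI) (rule bounded_linear_imp_has_derivative[OF assms])
  then show ?thesis
    using Suc assms by (simp add: Ck_on_const bounded_linear_imp_differentiable_on)
qed

lemma Ck_on_add:
  assumes "open S" "Ck_on k S f" "Ck_on k S g"
  shows "Ck_on k S (\<lambda>x. f x + g x)"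
  using assms(2,3)
proof (induction k arbitrary: f g)
  case (Suc k)
  have "Ck_on k S (pd b (\<lambda>x. f x + g x)) \<longleftrightarrow> Ck_on k S (\<lambda>x. pd b f x + pd b g x)" for b
    using Suc.prems
    by (intro Ck_on_cong[OF assms(1)] pd_eqI)
      (auto intro!: derivative_eq_intros has_derivative_frechet_derivative[OF assms(1)])
  then show ?case using Suc by simp
qed (simp add: continuous_on_add)

lemma Ck_on_mult:
  assumes "open S" "Ck_on k S f" "Ck_on k S g"
  shows "Ck_on k S (\<lambda>x. f x * g x)"
  using assms(2,3)
proof (induction k arbitrary: f g)
  case (Suc k)
  have "Ck_on k S (pd b (\<lambda>x. f x * g x)) \<longleftrightarrow> Ck_on k S (\<lambda>x. f x * pd b g x + pd b f x * g x)" for b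
    using Suc.prems
    by (intro Ck_on_cong[OF assms(1)] pd_eqI)
      (auto intro!: derivative_eq_intros has_derivative_frechet_derivative[OF assms(1)])
  \<comment> \<open>The product rule keeps undifferentiated factors, so the induction hypothesis is
    also applied to f and g themselves, one order lower.\<close>
  then show ?case using Suc Suc.prems[THEN Ck_on_SucD] by (auto intro!: Ck_on_add[OF assms(1)])
qed (simp add: continuous_on_mult)

lemma Ck_on_sum:
  assumes "open S" "\<And>i. i \<in> I \<Longrightarrow> Ck_on k S (f i)"
  shows "Ck_on k S (\<lambda>x. \<Sum>i\<in>I. f i x)"
  using assms(2)
  by (induction I rule: infinite_finite_induct) (auto intro: Ck_on_const Ck_on_add[OF assms(1)])

lemma Ck_on_powr:
  assumes "open S" "Ck_on k S f" "\<And>x. x \<in> S \<Longrightarrow> f x > 0"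
  shows "Ck_on k S (\<lambda>x. f x powr a)"
  using assms(2)
\<comment> \<open>Differentiation replaces the exponent a by a - 1, hence the generalization over
  a.\<close>
proof (induction k arbitrary: a)
  case 0
  then show ?case using assms(3) by (fastforce intro!: continuous_on_powr' continuous_on_const)
next
  case (Suc k)
  have d: "((\<lambda>x. f x powr a) has_derivative (\<lambda>v. a * f x powr (a - 1) * pd v f x)) (at x)"
    if "x \<in> S" for x
    using Suc.prems assms(1) assms(3)[OF that] that
    by (auto intro!: derivative_eq_intros has_derivative_frechet_derivative[OF assms(1)]
       simp: powr_diff field_simps)
  have "Ck_on k S (pd b (\<lambda>x. f x powr a)) \<longleftrightarrow> Ck_on k S (\<lambda>x. a * f x powr (a - 1) * pd b f x)" for b
    by (intro Ck_on_cong[OF assms(1)] pd_eqI d)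
  moreover have "(\<lambda>x. f x powr a) differentiable_on S"
    using d assms(1) by (auto simp: differentiable_on_eq_differentiable_at differentiable_def)
  ultimately show ?case
    using Suc Suc.prems[THEN Ck_on_SucD] by (auto intro!: Ck_on_mult[OF assms(1)] Ck_on_const)
qed

text \<open>Curvature involves two derivatives of the metric, so this is all that is extracted from
  smoothness of \<psi>. A linear map on the reals is multiplication by its value at 1, which
  identifies \<open>pd 1\<close> with the ordinary derivative.\<close>

lemma smooth_on_imp_derivs:
  fixes \<psi> :: "real \<Rightarrow> real"
  assumes "open J" "smooth_on J \<psi>"
  obtains \<psi>1 \<psi>2 where "\<And>r. r \<in> J \<Longrightarrow> (\<psi> has_real_derivative \<psi>1 r) (at r)"
    "\<And>r. r \<in> J \<Longrightarrow> (\<psi>1 has_real_derivative \<psi>2 r) (at r)"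
proof -
  have d: "(f has_real_derivative pd 1 f r) (at r)" if "f differentiable_on J" "r \<in> J" for f r
  proof -
    note D = has_derivative_frechet_derivative[OF assms(1) that]
    have "(\<lambda>v. pd v f r) = (*) (pd 1 f r)"
    proof
      show "pd v f r = pd 1 f r * v" for v
        using linear_scale[OF has_derivative_linear[OF D], of v 1] by simp
    qed
    then show ?thesis using D unfolding has_field_derivative_def by simp
  qed
  have "Ck_on (Suc (Suc 0)) J \<psi>" using assms(2) unfolding smooth_on_def by blast
  then have "\<psi> differentiable_on J" "pd 1 \<psi> differentiable_on J" by auto
  then show ?thesis using d by (intro that[of "pd 1 \<psi>" "pd 1 (pd 1 \<psi>)"]) auto
qed

subsection \<open>Curvature of a radial conformal metric\<close>

lemma pe_r_has_derivative:
  "(pe_r \<epsilon> has_derivative (\<lambda>v. \<Sum>k\<in>UNIV. 2 * \<epsilon> k * x $ k * v $ k)) (at x)"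
proof -
  have "((\<lambda>x. \<Sum>k\<in>UNIV. \<epsilon> k * (x $ k)\<^sup>2) has_derivative (\<lambda>v. \<Sum>k\<in>UNIV. 2 * \<epsilon> k * x $ k * v $ k)) (at x)"
    by (auto intro!: derivative_eq_intros bounded_linear.has_derivative[OF bounded_linear_vec_nth]
        sum.cong simp: algebra_simps)
  then show ?thesis unfolding pe_r_def[abs_def] .
qed

lemma sum_axis_pe_r: "(\<Sum>k\<in>UNIV. 2 * \<epsilon> k * x $ k * axis i 1 $ k) = 2 * \<epsilon> i * (x $ i :: real)"
  by (simp add: axis_def if_distrib[where f="\<lambda>a. _ * a"] cong: if_cong)

lemma continuous_pe_r: "continuous_on S (pe_r \<epsilon>)"
  unfolding pe_r_def[abs_def] by (intro continuous_intros)

lemma open_pe_r_vimage: "open J \<Longrightarrow> open (pe_r \<epsilon> -` J)"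
  using continuous_pe_r open_vimage by blast

lemma conf_metric_nth:
  "conf_metric \<epsilon> \<psi> y $ i $ j = (if i = j then \<epsilon> i / (\<psi> (pe_r \<epsilon> y))\<^sup>2 else 0)"
  by (simp add: conf_metric_def pe_metric_def)

text \<open>\<open>matrix_inv\<close> is defined by choice. The witness B makes the chosen matrix a
  genuine left inverse of A, and a left inverse equals the right inverse B.\<close>

lemma matrix_inv_eqI:
  fixes A B :: "real^'n^'n"
  assumes "A ** B = mat 1" "B ** A = mat 1"
  shows "matrix_inv A = B"
proof -
  have "matrix_inv A ** A = mat 1"
    unfolding matrix_inv_def using someI[of "\<lambda>A'. A ** A' = mat 1 \<and> A' ** A = mat 1" B] assms by blast
  then have "matrix_inv A ** A ** B = B" by simp
  then show ?thesis using assms(1) by (metis matrix_mul_assoc matrix_mul_rid)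
qed

lemma matrix_inv_conf_metric:
  fixes \<epsilon> :: "'n::finite \<Rightarrow> real"
  assumes eps: "\<And>i. \<epsilon> i = 1 \<or> \<epsilon> i = - 1" and "\<psi> (pe_r \<epsilon> x) \<noteq> 0"
  shows "matrix_inv (conf_metric \<epsilon> \<psi> x) $ i $ j = (if i = j then \<epsilon> i * (\<psi> (pe_r \<epsilon> x))\<^sup>2 else 0)"
proof -
  have e: "\<epsilon> i * \<epsilon> i = 1" for i using eps[of i] by auto
  have "matrix_inv (conf_metric \<epsilon> \<psi> x) = (\<chi> i j. if i = j then \<epsilon> i * (\<psi> (pe_r \<epsilon> x))\<^sup>2 else 0)"
    using assms(2)
    by (intro matrix_inv_eqI)
      (auto simp: matrix_matrix_mult_def vec_eq_iff conf_metric_nth mat_def e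
        if_distrib[where f="\<lambda>a. a * _"] if_distrib[where f="\<lambda>a. _ * a"] cong: if_cong)
  then show ?thesis by simp
qed

lemma pd_radial:
  assumes "(f has_real_derivative D) (at (pe_r \<epsilon> x))"
  shows "pdi i (\<lambda>y. f (pe_r \<epsilon> y)) x = 2 * \<epsilon> i * x $ i * D"
proof -
  have "((\<lambda>y. f (pe_r \<epsilon> y)) has_derivative (\<lambda>v. (\<Sum>k\<in>UNIV. 2 * \<epsilon> k * x $ k * v $ k) * D)) (at x)"
    using has_derivative_compose[OF pe_r_has_derivative assms[unfolded has_field_derivative_def]]
    by (simp add: mult.commute)
  from pd_eqI[OF this] show ?thesis by (simp add: sum_axis_pe_r)
qed

text \<open>With f = - ln |\<psi>(r)| the metric is exp(2f) g, and the Christoffel symbols of such a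
  metric over a flat g are combinations of the partial derivatives of f. Here the i-th one is - 2
  \<epsilon>_i x_i D / \<psi>.\<close>

lemma christoffel_conf_metric:
  fixes \<epsilon> :: "'n::finite \<Rightarrow> real"
  assumes eps: "\<And>i. \<epsilon> i = 1 \<or> \<epsilon> i = - 1"
    and d: "(\<psi> has_real_derivative D) (at (pe_r \<epsilon> x))" and nz: "\<psi> (pe_r \<epsilon> x) \<noteq> 0"
  shows "christoffel (conf_metric \<epsilon> \<psi>) k i j x = - 2 * D / \<psi> (pe_r \<epsilon> x) *
    ((if j = k then \<epsilon> i * x $ i else 0) + (if i = k then \<epsilon> j * x $ j else 0)
      - (if i = j then \<epsilon> i * x $ k else 0))"
proof -
  define p where "p = \<psi> (pe_r \<epsilon> x)"
  have p: "p \<noteq> 0" using nz by (simp add: p_def)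
  have e: "\<epsilon> i * \<epsilon> i = 1" "\<epsilon> i * (\<epsilon> i * c) = c" for i c using eps[of i] by auto
  have D: "((\<lambda>r. \<epsilon> i / (\<psi> r)\<^sup>2) has_real_derivative \<epsilon> i * (- 2 * D / p ^ 3)) (at (pe_r \<epsilon> x))" for i
    using p by (auto intro!: derivative_eq_intros d simp: p_def[symmetric] power_eq_if field_simps)
  have P: "pdi l (\<lambda>y. conf_metric \<epsilon> \<psi> y $ i $ j) x =
      (if i = j then 2 * \<epsilon> l * x $ l * (\<epsilon> i * (- 2 * D / p ^ 3)) else 0)" for l i j
    unfolding conf_metric_nth using pd_radial[OF D]
    by (auto intro!: pd_eqI[where f'="\<lambda>_. 0"])
  have "christoffel (conf_metric \<epsilon> \<psi>) k i j x = \<epsilon> k * p\<^sup>2 *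
        (pdi i (\<lambda>y. conf_metric \<epsilon> \<psi> y $ j $ k) x + pdi j (\<lambda>y. conf_metric \<epsilon> \<psi> y $ i $ k) x
          - pdi k (\<lambda>y. conf_metric \<epsilon> \<psi> y $ i $ j) x) / 2"
    unfolding christoffel_def using nz
    by (simp add: matrix_inv_conf_metric[OF eps] p_def if_distrib[where f="\<lambda>a. a * _"] cong: if_cong)
  also have "\<dots> = - 2 * D / p *
    ((if j = k then \<epsilon> i * x $ i else 0) + (if i = k then \<epsilon> j * x $ j else 0)
      - (if i = j then \<epsilon> i * x $ k else 0))"
    unfolding P using p by (auto simp: field_simps power_eq_if e)
  finally show ?thesis by (simp add: p_def)
qed

text \<open>This is the classical formula K = - (n-1) exp(-2f) (2 \<Delta>f + (n-2) |grad f|^2) for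
  exp(2f) g with g flat. For f = - ln |\<psi>(r)| the derivative in r is q/2, so \<Delta>f = 2 r q'
  + n q and |grad f|^2 = r q^2.\<close>

lemma scalar_curvature_conf_metric:
  fixes \<epsilon> :: "'n::finite \<Rightarrow> real"
  assumes eps: "\<And>i. \<epsilon> i = 1 \<or> \<epsilon> i = - 1"
    and J: "open J" "pe_r \<epsilon> x \<in> J"
    and d: "\<And>r. r \<in> J \<Longrightarrow> (\<psi> has_real_derivative \<psi>1 r) (at r)"
    and nz: "\<And>r. r \<in> J \<Longrightarrow> \<psi> r \<noteq> 0"
    and q: "\<And>r. r \<in> J \<Longrightarrow> q r = - 2 * \<psi>1 r / \<psi> r"
    and dq: "(q has_real_derivative q1) (at (pe_r \<epsilon> x))"
  shows "scalar_curvature (conf_metric \<epsilon> \<psi>) x = (1 - real CARD('n)) * (\<psi> (pe_r \<epsilon> x))\<^sup>2 *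
    (4 * pe_r \<epsilon> x * q1 + 2 * real CARD('n) * q (pe_r \<epsilon> x)
      + (real CARD('n) - 2) * pe_r \<epsilon> x * (q (pe_r \<epsilon> x))\<^sup>2)"
proof -
  define r where "r = pe_r \<epsilon> x"
  define Q where "Q = q r"
  define n where "n = real CARD('n)"
  define \<Gamma> where "\<Gamma> k i j y = ((if j = k then \<epsilon> i * y $ i else 0) + (if i = k then \<epsilon> j * y $ j else 0)
      - (if i = j then \<epsilon> i * y $ k else 0))" for k i j :: 'n and y :: "real^'n"
  have e: "\<epsilon> i * \<epsilon> i = 1" "\<epsilon> i * (\<epsilon> i * c) = c" for i c using eps[of i] by auto
  have chr: "christoffel (conf_metric \<epsilon> \<psi>) k i j y = q (pe_r \<epsilon> y) * \<Gamma> k i j y"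
    if "pe_r \<epsilon> y \<in> J" for k i j y
    using christoffel_conf_metric[OF eps d[OF that] nz[OF that]] q[OF that] by (simp add: \<Gamma>_def)
  have dQ: "((\<lambda>y. q (pe_r \<epsilon> y)) has_derivative (\<lambda>v. (\<Sum>k\<in>UNIV. 2 * \<epsilon> k * x $ k * v $ k) * q1)) (at x)"
    using has_derivative_compose[OF pe_r_has_derivative dq[unfolded has_field_derivative_def]]
    by (simp add: mult.commute)
  \<comment> \<open>\<open>\<Gamma> k i j\<close> is linear in the point, hence its own derivative.
    All nonlinearity of the Christoffel symbols sits in the radial factor q.\<close>
  have dG: "(\<Gamma> k i j has_derivative \<Gamma> k i j) (at x)" for k i j
    unfolding \<Gamma>_def[abs_def]
    by (cases "i = j"; cases "j = k"; cases "i = k")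
      (auto intro!: derivative_eq_intros bounded_linear.has_derivative[OF bounded_linear_vec_nth])
  have pdc: "pdi l (christoffel (conf_metric \<epsilon> \<psi>) k i j) x
      = 2 * \<epsilon> l * x $ l * q1 * \<Gamma> k i j x + Q * \<Gamma> k i j (axis l 1)" for l k i j
  proof -
    have "pdi l (christoffel (conf_metric \<epsilon> \<psi>) k i j) x = pdi l (\<lambda>y. q (pe_r \<epsilon> y) * \<Gamma> k i j y) x"
      by (rule pd_cong_open[OF open_pe_r_vimage[OF J(1), of \<epsilon>]]) (use J(2) chr in auto)
    also have "\<dots> = Q * \<Gamma> k i j (axis l 1) + (\<Sum>k\<in>UNIV. 2 * \<epsilon> k * x $ k * axis l 1 $ k) * q1 * \<Gamma> k i j x"
      using pd_eqI[OF has_derivative_mult[OF dQ dG]] by (simp add: Q_def r_def)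
    finally show ?thesis by (simp add: sum_axis_pe_r)
  qed
  have r: "(\<Sum>k\<in>UNIV. \<epsilon> k * (x $ k * x $ k)) = r"
    by (simp add: r_def pe_r_def power2_eq_square)
  \<comment> \<open>The inverse metric is diagonal, so the trace sees only the diagonal Ricci
    components. The four sums in the definition are evaluated one by one.\<close>
  have ric: "ricci (conf_metric \<epsilon> \<psi>) i i x =
     q1 * ((4 - 2 * n) * (x $ i)\<^sup>2 - 2 * \<epsilon> i * r) + Q * \<epsilon> i * (2 - 2 * n)
     + Q\<^sup>2 * ((n - 2) * ((x $ i)\<^sup>2 - \<epsilon> i * r))" for i
  proof -
    have "(\<Sum>k\<in>UNIV. pdi k (christoffel (conf_metric \<epsilon> \<psi>) k i i) x)
       = q1 * (4 * (x $ i)\<^sup>2 - 2 * \<epsilon> i * r) + Q * \<epsilon> i * (2 - n)"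
    proof -
      have "pdi k (christoffel (conf_metric \<epsilon> \<psi>) k i i) x =
          (if k = i then 4 * q1 * (x $ i)\<^sup>2 + 2 * Q * \<epsilon> i else 0)
          - 2 * q1 * \<epsilon> i * (\<epsilon> k * (x $ k * x $ k)) - Q * \<epsilon> i" for k
        unfolding pdc by (auto simp: \<Gamma>_def axis_def algebra_simps power2_eq_square e)
      then show ?thesis
        by (simp add: sum.distrib sum_subtractf flip: sum_distrib_left n_def)
          (simp add: r algebra_simps)
    qed
    moreover have "(\<Sum>k\<in>UNIV. pdi i (christoffel (conf_metric \<epsilon> \<psi>) k i k) x)
       = n * (2 * q1 * (x $ i)\<^sup>2 + Q * \<epsilon> i)"
    proof -
      have "pdi i (christoffel (conf_metric \<epsilon> \<psi>) k i k) x = 2 * q1 * (x $ i)\<^sup>2 + Q * \<epsilon> i" for k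
        unfolding pdc by (auto simp: \<Gamma>_def axis_def algebra_simps power2_eq_square e)
      then show ?thesis by (simp add: n_def)
    qed
    moreover have "(\<Sum>k\<in>UNIV. \<Sum>l\<in>UNIV. christoffel (conf_metric \<epsilon> \<psi>) k k l x * christoffel (conf_metric \<epsilon> \<psi>) l i i x)
       = n * Q\<^sup>2 * (2 * (x $ i)\<^sup>2 - \<epsilon> i * r)"
    proof -
      have "christoffel (conf_metric \<epsilon> \<psi>) k k l x * christoffel (conf_metric \<epsilon> \<psi>) l i i x =
          (if l = i then 2 * Q\<^sup>2 * (x $ i)\<^sup>2 else 0) - Q\<^sup>2 * \<epsilon> i * (\<epsilon> l * (x $ l * x $ l))" for k l
        unfolding chr[OF J(2)]
        by (auto simp: \<Gamma>_def Q_def r_def algebra_simps power2_eq_square e)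
      then show ?thesis
        by (simp add: sum.distrib sum_subtractf flip: sum_distrib_left n_def)
          (simp add: r algebra_simps)
    qed
    moreover have "(\<Sum>k\<in>UNIV. \<Sum>l\<in>UNIV. christoffel (conf_metric \<epsilon> \<psi>) k i l x * christoffel (conf_metric \<epsilon> \<psi>) l i k x)
       = Q\<^sup>2 * ((n + 2) * (x $ i)\<^sup>2 - 2 * \<epsilon> i * r)"
    proof -
      \<comment> \<open>A factor vanishes unless two of its indices agree, so the product splits
        into terms supported on coincidences among i, k and l.\<close>
      have "christoffel (conf_metric \<epsilon> \<psi>) k i l x * christoffel (conf_metric \<epsilon> \<psi>) l i k x =
          (if l = k then Q\<^sup>2 * (x $ i)\<^sup>2 else 0)
          + (if k = i then if l = i then 2 * Q\<^sup>2 * (x $ i)\<^sup>2 else 0 else 0)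
          - (if k = i then Q\<^sup>2 * \<epsilon> i * (\<epsilon> l * (x $ l * x $ l)) else 0)
          - (if l = i then Q\<^sup>2 * \<epsilon> i * (\<epsilon> k * (x $ k * x $ k)) else 0)" for k l
        unfolding chr[OF J(2)]
        by (auto simp: \<Gamma>_def Q_def r_def algebra_simps power2_eq_square e)
      \<comment> \<open>The condition k = i has to leave the inner sum over l before the outer sum
        can collapse.\<close>
      moreover have "(\<Sum>l\<in>UNIV. if k = i then f l else 0) = (if k = i then \<Sum>l\<in>UNIV. f l else 0)"
        for k and f :: "'n \<Rightarrow> real" by simp
      ultimately show ?thesis
        by (simp add: sum.distrib sum_subtractf flip: sum_distrib_left n_def)
          (simp add: r algebra_simps)
    qed
    ultimately show ?thesis
      unfolding ricci_def by (simp add: sum_subtractf algebra_simps)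
  qed
  have "scalar_curvature (conf_metric \<epsilon> \<psi>) x = (\<Sum>i\<in>UNIV. \<epsilon> i * (\<psi> r)\<^sup>2 * ricci (conf_metric \<epsilon> \<psi>) i i x)"
    unfolding scalar_curvature_def using nz[OF J(2)]
    by (simp add: matrix_inv_conf_metric[OF eps] r_def if_distrib[where f="\<lambda>a. a * _"] cong: if_cong)
  \<comment> \<open>Multiplication by \<epsilon> i turns the squared coordinate into a summand of r,
    and \<epsilon> i itself into 1.\<close>
  also have "\<dots> = (\<psi> r)\<^sup>2 * (\<Sum>i\<in>UNIV. q1 * ((4 - 2 * n) * (\<epsilon> i * (x $ i * x $ i)) - 2 * r) + Q * (2 - 2 * n)
     + Q\<^sup>2 * ((n - 2) * (\<epsilon> i * (x $ i * x $ i) - r)))"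
    unfolding ric sum_distrib_left
    by (rule sum.cong) (auto simp: algebra_simps e power2_eq_square)
  also have "\<dots> = (1 - n) * (\<psi> r)\<^sup>2 * (4 * r * q1 + 2 * n * Q + (n - 2) * r * Q\<^sup>2)"
    by (simp add: sum.distrib sum_subtractf flip: sum_distrib_left n_def)
      (simp add: r algebra_simps)
  finally show ?thesis by (simp add: r_def Q_def n_def)
qed

subsection \<open>The Euler equation\<close>

text \<open>The intermediate value theorem, with the sign kept as a factor so that both signs are
  treated at once. It is applied to r, giving |r| = \<sigma> r, and later to |r|^(-m) + A.\<close>

lemma connected_nonzero_sign:
  fixes f :: "'a::topological_space \<Rightarrow> real"
  assumes "connected J" "continuous_on J f" "\<And>x. x \<in> J \<Longrightarrow> f x \<noteq> 0"
  shows "\<exists>\<sigma>. (\<sigma> = 1 \<or> \<sigma> = - 1) \<and> (\<forall>x\<in>J. \<sigma> * f x > 0)"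
proof -
  have iv: "connected (f ` J)" using assms(1,2) by (rule connected_continuous_image[rotated])
  have "(\<forall>x\<in>J. f x > 0) \<or> (\<forall>x\<in>J. f x < 0)"
  proof (rule ccontr)
    assume "\<not> ?thesis"
    then obtain x y where "x \<in> J" "y \<in> J" "f x \<le> 0" "f y \<ge> 0" by force
    then have "0 \<in> f ` J"
      using connectedD_interval[OF iv, of "f x" "f y" 0] by blast
    then show False using assms(3) by force
  qed
  then show ?thesis
    by (auto intro: exI[of _ 1] exI[of _ "- 1"])
qed

lemma DERIV_zero_imp_constant:
  fixes f :: "real \<Rightarrow> real"
  assumes "connected J" "\<And>x. x \<in> J \<Longrightarrow> (f has_real_derivative 0) (at x)"
  obtains c where "\<And>x. x \<in> J \<Longrightarrow> f x = c"
proof -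
  have "convex J" using assms(1) by (simp add: is_interval_connected_1 flip: is_interval_convex_1)
  from has_field_derivative_zero_constant[OF this, of f] show ?thesis
    using assms(2) that by (blast intro: has_field_derivative_at_within)
qed

lemma DERIV_abs_powr:
  fixes \<sigma> r a :: real
  assumes "\<sigma> = 1 \<or> \<sigma> = - 1" "\<sigma> * r > 0"
  shows "((\<lambda>r. (\<sigma> * r) powr a) has_real_derivative a * \<sigma> * (\<sigma> * r) powr (a - 1)) (at r)"
  using assms(2) by (auto intro!: derivative_eq_intros simp: powr_diff)

text \<open>The first integral r^(n/2) u' is squared to obtain the integer exponent n. The result is
  differentiable across r = 0 and for both signs of r, and vanishes at 0.\<close>

lemma euler_ode_vanishes:
  fixes u1 u2 :: "real \<Rightarrow> real"
  assumes J: "connected J" "0 \<in> J" and n: "n \<ge> 1"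
    and d: "\<And>r. r \<in> J \<Longrightarrow> (u1 has_real_derivative u2 r) (at r)"
    and ode: "\<And>r. r \<in> J \<Longrightarrow> 2 * r * u2 r + real n * u1 r = 0"
    and r: "r \<in> J"
  shows "u1 r = 0"
proof (cases "r = 0")
  case True
  then show ?thesis using ode[OF r] n by simp
next
  case False
  obtain c where c: "\<And>r. r \<in> J \<Longrightarrow> r ^ n * (u1 r)\<^sup>2 = c"
  proof (rule DERIV_zero_imp_constant[OF J(1), of "\<lambda>r. r ^ n * (u1 r)\<^sup>2"])
    fix r assume r: "r \<in> J"
    have "real n * r ^ (n - 1) * (u1 r)\<^sup>2 + r ^ n * (2 * u1 r * u2 r)
        = r ^ (n - 1) * u1 r * (2 * r * u2 r + real n * u1 r)"
      using n by (cases n) (simp_all add: power2_eq_square algebra_simps)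
    then have "real n * r ^ (n - 1) * (u1 r)\<^sup>2 + r ^ n * (2 * u1 r * u2 r) = 0"
      using ode[OF r] by simp
    moreover have "((\<lambda>r. r ^ n * (u1 r)\<^sup>2) has_real_derivative
        real n * r ^ (n - 1) * (u1 r)\<^sup>2 + r ^ n * (2 * u1 r * u2 r)) (at r)"
      by (auto intro!: derivative_eq_intros d[OF r])
    ultimately show "((\<lambda>r. r ^ n * (u1 r)\<^sup>2) has_real_derivative 0) (at r)" by simp
  qed auto
  have "r ^ n * (u1 r)\<^sup>2 = 0" using c[OF r] c[OF J(2)] n by (simp add: power_0_left)
  then show ?thesis using False by simp
qed

lemma euler_ode_iff:
  fixes u u1 u2 :: "real \<Rightarrow> real"
  assumes J: "open J" "connected J" and \<sigma>: "\<sigma> = 1 \<or> \<sigma> = - 1" "\<And>r. r \<in> J \<Longrightarrow> \<sigma> * r > 0"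
    and m: "m > 0"
    and d1: "\<And>r. r \<in> J \<Longrightarrow> (u has_real_derivative u1 r) (at r)"
    and d2: "\<And>r. r \<in> J \<Longrightarrow> (u1 has_real_derivative u2 r) (at r)"
  shows "(\<forall>r\<in>J. r * u2 r + (m + 1) * u1 r = 0) \<longleftrightarrow> (\<exists>a b. \<forall>r\<in>J. u r = a + b * (\<sigma> * r) powr (- m))"
proof
  assume ode: "\<forall>r\<in>J. r * u2 r + (m + 1) * u1 r = 0"
  have \<sigma>\<sigma>: "\<sigma> * \<sigma> = 1" "\<sigma> * (\<sigma> * x) = x" for x using \<sigma>(1) by auto
  \<comment> \<open>The integrating factor |r|^(m+1) makes the equation say that |r|^(m+1) u' is
    constant.\<close>
  obtain c where c: "\<And>r. r \<in> J \<Longrightarrow> (\<sigma> * r) powr (m + 1) * u1 r = c"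
  proof (rule DERIV_zero_imp_constant[OF J(2), of "\<lambda>r. (\<sigma> * r) powr (m + 1) * u1 r"])
    fix r assume r: "r \<in> J"
    have "(m + 1) * \<sigma> * (\<sigma> * r) powr (m + 1 - 1) * u1 r + (\<sigma> * r) powr (m + 1) * u2 r
       = (\<sigma> * r) powr m * \<sigma> * (r * u2 r + (m + 1) * u1 r)"
      using \<sigma>(2)[OF r] by (simp add: powr_add algebra_simps)
    then have "(m + 1) * \<sigma> * (\<sigma> * r) powr (m + 1 - 1) * u1 r + (\<sigma> * r) powr (m + 1) * u2 r = 0"
      using ode r by simp
    moreover have "((\<lambda>r. (\<sigma> * r) powr (m + 1) * u1 r) has_real_derivative
      (m + 1) * \<sigma> * (\<sigma> * r) powr (m + 1 - 1) * u1 r + (\<sigma> * r) powr (m + 1) * u2 r) (at r)"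
      using DERIV_mult[OF DERIV_abs_powr[OF \<sigma>(1) \<sigma>(2)[OF r], of "m + 1"] d2[OF r]]
      by (simp only: mult.commute)
    ultimately show "((\<lambda>r. (\<sigma> * r) powr (m + 1) * u1 r) has_real_derivative 0) (at r)" by simp
  qed auto
  \<comment> \<open>Hence u' = c |r|^(-m-1), with antiderivative - (c \<sigma> / m) |r|^(-m);
    subtracting it from u leaves a constant.\<close>
  obtain a where a: "\<And>r. r \<in> J \<Longrightarrow> u r + c * \<sigma> / m * (\<sigma> * r) powr (- m) = a"
  proof (rule DERIV_zero_imp_constant[OF J(2), of "\<lambda>r. u r + c * \<sigma> / m * (\<sigma> * r) powr (- m)"])
    fix r assume r: "r \<in> J"
    have "u1 r = c * (\<sigma> * r) powr (- m - 1)"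
    proof -
      have "c * (\<sigma> * r) powr (- m - 1) = u1 r * ((\<sigma> * r) powr (m + 1) * (\<sigma> * r) powr (- m - 1))"
        unfolding c[OF r, symmetric] by (simp only: ac_simps)
      also have "(\<sigma> * r) powr (m + 1) * (\<sigma> * r) powr (- m - 1) = 1"
        using less_imp_neq[OF \<sigma>(2)[OF r]] by (simp flip: powr_add)
      finally show ?thesis by simp
    qed
    then have "u1 r + c * \<sigma> / m * (- m * \<sigma> * (\<sigma> * r) powr (- m - 1)) = 0"
      using m by (simp add: \<sigma>\<sigma>)
    moreover have "((\<lambda>r. u r + c * \<sigma> / m * (\<sigma> * r) powr (- m)) has_real_derivative
        u1 r + c * \<sigma> / m * (- m * \<sigma> * (\<sigma> * r) powr (- m - 1))) (at r)"
      by (intro DERIV_add d1[OF r] DERIV_cmult DERIV_abs_powr \<sigma>(1) \<sigma>(2)[OF r])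
    ultimately show "((\<lambda>r. u r + c * \<sigma> / m * (\<sigma> * r) powr (- m)) has_real_derivative 0) (at r)"
      by simp
  qed auto
  have "\<forall>r\<in>J. u r = a + (- c * \<sigma> / m) * (\<sigma> * r) powr (- m)"
    using a by (simp add: algebra_simps eq_diff_eq)
  then show "\<exists>a b. \<forall>r\<in>J. u r = a + b * (\<sigma> * r) powr (- m)" by blast
next
  assume "\<exists>a b. \<forall>r\<in>J. u r = a + b * (\<sigma> * r) powr (- m)"
  then obtain a b where ab: "\<And>r. r \<in> J \<Longrightarrow> a + b * (\<sigma> * r) powr (- m) = u r" by auto
  have \<sigma>\<sigma>: "\<sigma> * \<sigma> = 1" "\<sigma> * (\<sigma> * x) = x" for x using \<sigma>(1) by auto
  \<comment> \<open>\<open>u1\<close> and \<open>u2\<close> are known only as derivatives.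
    Uniqueness of derivatives on the open set J identifies them with the explicit formulas.\<close>
  have u1: "b * (- m * \<sigma> * (\<sigma> * r) powr (- m - 1)) = u1 r" if r: "r \<in> J" for r
  proof -
    have "((\<lambda>r. a + b * (\<sigma> * r) powr (- m)) has_real_derivative
       0 + b * (- m * \<sigma> * (\<sigma> * r) powr (- m - 1))) (at r)"
      by (intro DERIV_add DERIV_const DERIV_cmult DERIV_abs_powr \<sigma>(1) \<sigma>(2)[OF r])
    from has_field_derivative_transform_within_open[OF this J(1) r ab]
    show ?thesis using DERIV_unique[OF d1[OF r]] by simp
  qed
  have u2: "b * (- m * \<sigma> * ((- m - 1) * \<sigma> * (\<sigma> * r) powr (- m - 1 - 1))) = u2 r" if r: "r \<in> J" for r
  proof -
    have "((\<lambda>r. b * (- m * \<sigma> * (\<sigma> * r) powr (- m - 1))) has_real_derivative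
       b * (- m * \<sigma> * ((- m - 1) * \<sigma> * (\<sigma> * r) powr (- m - 1 - 1)))) (at r)"
      by (intro DERIV_cmult DERIV_abs_powr \<sigma>(1) \<sigma>(2)[OF r])
    from has_field_derivative_transform_within_open[OF this J(1) r u1]
    show ?thesis using DERIV_unique[OF d2[OF r]] by simp
  qed
  show "\<forall>r\<in>J. r * u2 r + (m + 1) * u1 r = 0"
  proof
    fix r assume r: "r \<in> J"
    have p: "(\<sigma> * r) powr (- m - 1) = \<sigma> * r * (\<sigma> * r) powr (- m - 1 - 1)"
    proof -
      have "1 + (- m - 1 - 1) = - m - 1" by simp
      then show ?thesis
        using powr_mult_base[of "\<sigma> * r" "- m - 1 - 1"] less_imp_le[OF \<sigma>(2)[OF r]] by metis
    qed
    show "r * u2 r + (m + 1) * u1 r = 0"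
      unfolding u1[OF r, symmetric] u2[OF r, symmetric] p
      by (simp add: algebra_simps \<sigma>\<sigma>)
  qed
qed

section \<open>From u back to \<psi>: the classification of scalar-flat factors\<close>

lemma psi_sol_powr:
  assumes m: "m = (real n - 2) / 2" "m > 0" and k: "k > 0" and r: "r \<noteq> 0"
  shows "psi_sol n A k r = k * \<bar>\<bar>r\<bar> powr (- m) + A\<bar> powr (- 1 / m)"
proof -
  have "\<bar>\<bar>r\<bar> powr (- m) + A\<bar> = \<bar>r\<bar> powr (- m) * \<bar>1 + A * \<bar>r\<bar> powr m\<bar>"
  proof -
    \<comment> \<open>Factoring out |r|^(-m) is what matters: the power -1/m turns this factor into
      the numerator |r| of \<open>psi_sol\<close>.\<close>
    have "\<bar>r\<bar> powr (- m) + A = \<bar>r\<bar> powr (- m) * (1 + A * \<bar>r\<bar> powr m)"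
      using r by (simp add: algebra_simps flip: powr_add)
    then show ?thesis by (simp add: abs_mult)
  qed
  then have "\<bar>\<bar>r\<bar> powr (- m) + A\<bar> powr (- 1 / m) = \<bar>r\<bar> * \<bar>1 + A * \<bar>r\<bar> powr m\<bar> powr (- 1 / m)"
    using m(2) r by (simp add: powr_mult powr_powr)
  moreover have "2 / (real n - 2) = 1 / m" unfolding m(1) by simp
  ultimately show ?thesis
    unfolding psi_sol_def m(1)[symmetric] by (simp add: powr_minus field_simps)
qed

text \<open>Since J lies in the range of r, flatness at all points x over J is an ordinary
  differential equation on all of J. Nonconstancy excludes the solutions without a |r|^(-m)
  term.\<close>

lemma scalar_flat_conf_metric_iff:
  fixes \<epsilon> :: "'n::finite \<Rightarrow> real"
  assumes n: "CARD('n) \<ge> 3" and eps: "\<And>i. \<epsilon> i = 1 \<or> \<epsilon> i = - 1"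
    and J: "open J" "connected J" "J \<subseteq> range (pe_r \<epsilon>)"
    and sm: "smooth_on J \<psi>" and pos: "\<And>r. r \<in> J \<Longrightarrow> \<psi> r > 0" and nc: "\<not> \<psi> constant_on J"
  shows "(\<forall>x. pe_r \<epsilon> x \<in> J \<longrightarrow> scalar_curvature (conf_metric \<epsilon> \<psi>) x = 0) \<longleftrightarrow>
         (\<exists>A k. k > 0 \<and> (\<forall>r\<in>J. \<psi> r = psi_sol CARD('n) A k r))"
proof -
  obtain \<psi>1 \<psi>2 where d1: "\<And>r. r \<in> J \<Longrightarrow> (\<psi> has_real_derivative \<psi>1 r) (at r)"
    and d2: "\<And>r. r \<in> J \<Longrightarrow> (\<psi>1 has_real_derivative \<psi>2 r) (at r)"
    using smooth_on_imp_derivs[OF J(1) sm] by metis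
  define N where "N = real CARD('n)"
  define m where "m = (N - 2) / 2"
  have N: "N \<ge> 3" using n by (simp add: N_def)
  have m: "m > 0" using N by (simp add: m_def)
  define q where "q r = - 2 * \<psi>1 r / \<psi> r" for r
  define q1 where "q1 r = - 2 * (\<psi>2 r * \<psi> r - \<psi>1 r * \<psi>1 r) / (\<psi> r * \<psi> r)" for r
  define u where "u r = \<psi> r powr (- m)" for r
  \<comment> \<open>From u = \<psi>^(-m) follows u'/u = - m \<psi>'/\<psi> = m q / 2;
    \<open>u1\<close> and \<open>u2\<close> are the first two derivatives of u expressed through
    q.\<close>
  define u1 where "u1 r = m / 2 * q r * u r" for r
  define u2 where "u2 r = m / 2 * (q1 r * u r + u1 r * q r)" for r
  have dq: "(q has_real_derivative q1 r) (at r)" if "r \<in> J" for r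
    unfolding q_def[abs_def] q1_def using pos[OF that]
    by (auto intro!: derivative_eq_intros d1[OF that] d2[OF that] simp: divide_simps)
  have du: "(u has_real_derivative u1 r) (at r)" if "r \<in> J" for r
    unfolding u_def[abs_def] u1_def q_def using pos[OF that]
    by (auto intro!: derivative_eq_intros d1[OF that] simp: powr_diff field_simps)
  have du1: "(u1 has_real_derivative u2 r) (at r)" if "r \<in> J" for r
    unfolding u1_def[abs_def] u2_def
    by (auto intro!: derivative_eq_intros dq[OF that] du[OF that] simp: u1_def algebra_simps)
  have nz: "\<psi> r \<noteq> 0" if "r \<in> J" for r using pos[OF that] by simp
  have upos: "u r > 0" if "r \<in> J" for r using pos[OF that] by (simp add: u_def)
  have \<psi>u: "\<psi> r = u r powr (- 1 / m)" if "r \<in> J" for r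
    using pos[OF that] m by (simp add: u_def powr_powr)
  have flat_iff: "scalar_curvature (conf_metric \<epsilon> \<psi>) x = 0 \<longleftrightarrow>
     pe_r \<epsilon> x * u2 (pe_r \<epsilon> x) + (m + 1) * u1 (pe_r \<epsilon> x) = 0" if x: "pe_r \<epsilon> x \<in> J" for x
  proof -
    let ?r = "pe_r \<epsilon> x"
    have "scalar_curvature (conf_metric \<epsilon> \<psi>) x = (1 - N) * (\<psi> ?r)\<^sup>2 *
        (4 * ?r * q1 ?r + 2 * N * q ?r + (N - 2) * ?r * (q ?r)\<^sup>2)"
      unfolding N_def
      by (rule scalar_curvature_conf_metric[OF eps J(1) x d1 nz q_def dq[OF x]])
    also have "\<dots> = 0 \<longleftrightarrow> 4 * ?r * q1 ?r + 2 * N * q ?r + (N - 2) * ?r * (q ?r)\<^sup>2 = 0"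
      using N pos[OF x] by simp
    \<comment> \<open>The factor m u / 8 linearizes the Riccati-type expression in q: with N = 2 m +
      2 it becomes exactly the Euler operator applied to u.\<close>
    also have "\<dots> \<longleftrightarrow> m / 8 * u ?r * (4 * ?r * q1 ?r + 2 * N * q ?r + (N - 2) * ?r * (q ?r)\<^sup>2) = 0"
      using upos[OF x] m by simp
    also have "m / 8 * u ?r * (4 * ?r * q1 ?r + 2 * N * q ?r + (N - 2) * ?r * (q ?r)\<^sup>2)
       = ?r * u2 ?r + (m + 1) * u1 ?r"
    proof -
      have "N = 2 * m + 2" using m_def by (simp add: field_simps)
      then show ?thesis by (simp add: u2_def u1_def power2_eq_square algebra_simps)
    qed
    finally show ?thesis .
  qed
  have K: "(\<forall>x. pe_r \<epsilon> x \<in> J \<longrightarrow> scalar_curvature (conf_metric \<epsilon> \<psi>) x = 0) \<longleftrightarrow>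
     (\<forall>r\<in>J. r * u2 r + (m + 1) * u1 r = 0)"
  proof (intro iffI allI ballI impI)
    fix r assume *: "\<forall>x. pe_r \<epsilon> x \<in> J \<longrightarrow> scalar_curvature (conf_metric \<epsilon> \<psi>) x = 0" and r: "r \<in> J"
    obtain x where "pe_r \<epsilon> x = r" using J(3) r by blast
    then show "r * u2 r + (m + 1) * u1 r = 0" using * r flat_iff[of x] by simp
  qed (use flat_iff in auto)
  have uc: False if "\<And>r. r \<in> J \<Longrightarrow> u r = c" for c
    using nc \<psi>u that unfolding constant_on_def by metis
  have mn: "m = (real CARD('n) - 2) / 2" by (simp add: m_def N_def)
  show ?thesis
  proof (cases "0 \<in> J")
    case True
    \<comment> \<open>If J contains 0, both sides of the equivalence fail: the equation forces u to
      be constant, and \<open>psi_sol\<close> vanishes at 0 while \<psi> is positive there.\<close>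
    have "\<not> (\<forall>r\<in>J. r * u2 r + (m + 1) * u1 r = 0)"
    proof
      assume ode: "\<forall>r\<in>J. r * u2 r + (m + 1) * u1 r = 0"
      have "u1 r = 0" if "r \<in> J" for r
      proof (rule euler_ode_vanishes[OF J(2) True _ du1 _ that])
        show "2 * r * u2 r + real CARD('n) * u1 r = 0" if "r \<in> J" for r
          using ode[rule_format, OF that] by (simp add: mn field_simps)
      qed (use n in auto)
      then show False
        using DERIV_zero_imp_constant[OF J(2), of u] du uc by metis
    qed
    moreover have "psi_sol CARD('n) A k 0 = 0" for A k by (simp add: psi_sol_def)
    ultimately show ?thesis using K pos[OF True] True by force
  next
    case False
    then obtain \<sigma> where \<sigma>: "\<sigma> = 1 \<or> \<sigma> = - 1" "\<And>r. r \<in> J \<Longrightarrow> \<sigma> * r > 0"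
      using connected_nonzero_sign[OF J(2) continuous_on_id] by force
    have abs: "\<bar>r\<bar> = \<sigma> * r" if "r \<in> J" for r using \<sigma>(1) \<sigma>(2)[OF that] by auto
    note K[unfolded euler_ode_iff[OF J(1,2) \<sigma> m du du1, simplified]]
    also have "(\<exists>a b. \<forall>r\<in>J. u r = a + b * (\<sigma> * r) powr (- m)) \<longleftrightarrow>
         (\<exists>A k. k > 0 \<and> (\<forall>r\<in>J. \<psi> r = psi_sol CARD('n) A k r))"
    proof
      assume "\<exists>a b. \<forall>r\<in>J. u r = a + b * (\<sigma> * r) powr (- m)"
      then obtain a b where ab: "\<And>r. r \<in> J \<Longrightarrow> u r = a + b * (\<sigma> * r) powr (- m)" by auto
      have b: "b \<noteq> 0" using uc[of a] ab by auto
      \<comment> \<open>Writing u = b (|r|^(-m) + a/b) and taking the power -1/m gives A = a/b and k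
        = |b|^(-1/m). The absolute values are harmless because u > 0.\<close>
      have "\<psi> r = psi_sol CARD('n) (a / b) (\<bar>b\<bar> powr (- 1 / m)) r" if r: "r \<in> J" for r
      proof -
        have "u r = b * ((\<sigma> * r) powr (- m) + a / b)" using ab[OF r] b by (simp add: algebra_simps)
        then have "\<bar>u r\<bar> = \<bar>b\<bar> * \<bar>\<bar>r\<bar> powr (- m) + a / b\<bar>" by (simp only: abs_mult abs[OF r])
        then have "u r = \<bar>b\<bar> * \<bar>\<bar>r\<bar> powr (- m) + a / b\<bar>" using upos[OF r] by simp
        then have "\<psi> r = \<bar>b\<bar> powr (- 1 / m) * \<bar>\<bar>r\<bar> powr (- m) + a / b\<bar> powr (- 1 / m)"
          using \<psi>u[OF r] by (simp add: powr_mult)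
        moreover have "\<bar>b\<bar> powr (- 1 / m) > 0" "r \<noteq> 0" using b r False by auto
        ultimately show ?thesis using psi_sol_powr[OF mn m] by simp
      qed
      then show "\<exists>A k. k > 0 \<and> (\<forall>r\<in>J. \<psi> r = psi_sol CARD('n) A k r)"
        using b by (intro exI[of _ "a / b"] exI[of _ "\<bar>b\<bar> powr (- 1 / m)"]) auto
    next
      assume "\<exists>A k. k > 0 \<and> (\<forall>r\<in>J. \<psi> r = psi_sol CARD('n) A k r)"
      then obtain A k where k: "k > 0"
        and sol: "\<And>r. r \<in> J \<Longrightarrow> \<psi> r = psi_sol CARD('n) A k r" by auto
      have s: "\<psi> r = k * \<bar>(\<sigma> * r) powr (- m) + A\<bar> powr (- 1 / m)" if r: "r \<in> J" for r
      proof -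
        have "r \<noteq> 0" using r False by auto
        from psi_sol_powr[OF mn m k this] show ?thesis unfolding sol[OF r] abs[OF r] .
      qed
      have "continuous_on J (\<lambda>r. (\<sigma> * r) powr (- m) + A)"
        using False \<sigma>(1) by (intro continuous_intros) auto
      \<comment> \<open>By the convention \<open>0 powr a = 0\<close>, a zero of this sum would be a
        zero of \<psi>. The sum therefore has a fixed sign \<tau> on J, which removes the absolute
        value.\<close>
      moreover have "(\<sigma> * r) powr (- m) + A \<noteq> 0" if "r \<in> J" for r
        using s[OF that] pos[OF that] by auto
      ultimately obtain \<tau> where \<tau>: "\<tau> = 1 \<or> \<tau> = - 1"
        "\<And>r. r \<in> J \<Longrightarrow> \<tau> * ((\<sigma> * r) powr (- m) + A) > 0"
        using connected_nonzero_sign[OF J(2), of "\<lambda>r. (\<sigma> * r) powr (- m) + A"] by auto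
      have "u r = k powr (- m) * \<tau> * A + k powr (- m) * \<tau> * (\<sigma> * r) powr (- m)" if r: "r \<in> J" for r
      proof -
        have "\<bar>(\<sigma> * r) powr (- m) + A\<bar> = \<tau> * ((\<sigma> * r) powr (- m) + A)" using \<tau>(1) \<tau>(2)[OF r] by auto
        moreover have "u r = k powr (- m) * \<bar>(\<sigma> * r) powr (- m) + A\<bar>"
          using k m by (simp add: u_def s[OF r] powr_mult powr_powr)
        ultimately show ?thesis by (simp add: algebra_simps)
      qed
      then show "\<exists>a b. \<forall>r\<in>J. u r = a + b * (\<sigma> * r) powr (- m)" by blast
    qed
    finally show ?thesis .
  qed
qed

subsection \<open>Regular and singular points\<close>

lemma Ck_on_pe_r: "open S \<Longrightarrow> Ck_on k S (pe_r \<epsilon>)"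
  unfolding pe_r_def[abs_def] power2_eq_square
  by (intro Ck_on_sum Ck_on_mult Ck_on_const Ck_on_linear bounded_linear_vec_nth)

text \<open>
  The absolute values are traded for powers of squares, which are smooth wherever they are positive.
\<close>
lemma inverse_psi_sol_sq:
  assumes "r \<noteq> 0"
  shows "1 / (psi_sol n A k r)\<^sup>2 = 1 / k\<^sup>2 * (r * r) powr (- 1) *
    ((1 + A * (r * r) powr ((real n - 2) / 4)) * (1 + A * (r * r) powr ((real n - 2) / 4))) powr (2 / (real n - 2))"
proof -
  have sq: "(x * x) powr a = (\<bar>x\<bar> powr a)\<^sup>2" "(x * x) powr a = \<bar>x\<bar> powr (2 * a)" for x a :: real
    by (simp_all add: powr_mult[of "\<bar>x\<bar>" "\<bar>x\<bar>", simplified] power2_eq_square flip: powr_add)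
  have "(r * r) powr ((real n - 2) / 4) = \<bar>r\<bar> powr ((real n - 2) / 2)"
    unfolding sq(2) by (rule arg_cong[of _ _ "(powr) \<bar>r\<bar>"]) simp
  moreover have "(r * r) powr (- 1) = 1 / r\<^sup>2"
    using assms by (simp add: sq(1) powr_minus power2_eq_square field_simps)
  ultimately show ?thesis
    unfolding psi_sol_def by (simp only: sq(1)) (simp add: power_divide power_mult_distrib)
qed

lemma det_conf_metric:
  fixes \<epsilon> :: "'n::finite \<Rightarrow> real"
  shows "det (conf_metric \<epsilon> \<psi> x) = (\<Prod>i\<in>UNIV. \<epsilon> i / (\<psi> (pe_r \<epsilon> x))\<^sup>2)"
  by (subst det_diagonal) (auto simp: conf_metric_nth)

text \<open>On S both r and 1 + A |r|^m, with m = (n-2)/2, are nonzero, so their squares are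
  positive and \<open>Ck_on_powr\<close> applies to the rewritten conformal factor.\<close>

lemma pseudo_metric_on_conf_psi_sol:
  fixes \<epsilon> :: "'n::finite \<Rightarrow> real"
  assumes eps: "\<And>i. \<epsilon> i = 1 \<or> \<epsilon> i = - 1" and S: "open S" "S \<subseteq> pe_r \<epsilon> -` psi_dom CARD('n) A" and k: "k > 0"
  shows "pseudo_metric_on S (conf_metric \<epsilon> (psi_sol CARD('n) A k))"
proof -
  let ?m = "real CARD('n) - 2"
  have nz: "pe_r \<epsilon> x \<noteq> 0" "1 + A * \<bar>pe_r \<epsilon> x\<bar> powr (?m / 2) \<noteq> 0" if "x \<in> S" for x
    using that S(2) by (auto simp: psi_dom_def)
  let ?F = "\<lambda>x. 1 + A * (pe_r \<epsilon> x * pe_r \<epsilon> x) powr (?m / 4)"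
  have F: "?F x \<noteq> 0" if "x \<in> S" for x
  proof -
    have "(pe_r \<epsilon> x * pe_r \<epsilon> x) powr (?m / 4) = \<bar>pe_r \<epsilon> x\<bar> powr (?m / 2)"
      by (simp add: powr_mult[of "\<bar>pe_r \<epsilon> x\<bar>" "\<bar>pe_r \<epsilon> x\<bar>", simplified] flip: powr_add)
    then show ?thesis using nz(2)[OF that] by simp
  qed
  have c: "Ck_on l S (\<lambda>x. 1 / (psi_sol CARD('n) A k (pe_r \<epsilon> x))\<^sup>2)" for l
  proof -
    have "Ck_on l S (\<lambda>x. 1 / k\<^sup>2 * (pe_r \<epsilon> x * pe_r \<epsilon> x) powr (- 1) * (?F x * ?F x) powr (2 / ?m))"
      using F nz(1)
      by (intro Ck_on_mult Ck_on_powr Ck_on_add Ck_on_const Ck_on_pe_r S(1))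
        (auto simp: zero_less_mult_iff linorder_neq_iff)
    then show ?thesis
      using nz(1) by (subst Ck_on_cong[OF S(1) inverse_psi_sol_sq]) auto
  qed
  have e: "conf_metric \<epsilon> (psi_sol CARD('n) A k) x $ i $ j =
     (if i = j then \<epsilon> i else 0) * (1 / (psi_sol CARD('n) A k (pe_r \<epsilon> x))\<^sup>2)" for x i j
    by (simp add: conf_metric_nth)
  have "smooth_on S (\<lambda>x. conf_metric \<epsilon> (psi_sol CARD('n) A k) x $ i $ j)" for i j
    unfolding smooth_on_def e by (intro allI Ck_on_mult Ck_on_const c S(1))
  moreover have "psi_sol CARD('n) A k (pe_r \<epsilon> x) \<noteq> 0" if "x \<in> S" for x
    using nz[OF that] k by (simp add: psi_sol_def)
  moreover have "\<epsilon> i \<noteq> 0" for i using eps[of i] by auto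
  ultimately show ?thesis
    unfolding pseudo_metric_on_def using S(1)
    by (auto simp: det_conf_metric transpose_def vec_eq_iff conf_metric_nth)
qed

section \<open>The singular set for A < 0\<close>

lemma open_psi_dom: "open (psi_dom n A)"
proof -
  have "continuous_on (- {0}) (\<lambda>r. 1 + A * \<bar>r\<bar> powr ((real n - 2) / 2))"
    by (intro continuous_intros) auto
  from continuous_open_preimage[OF this, of "- {0}"]
  have "open (- {0} \<inter> (\<lambda>r. 1 + A * \<bar>r\<bar> powr ((real n - 2) / 2)) -` (- {0}))"
    by (simp add: open_Compl)
  also have "- {0} \<inter> (\<lambda>r. 1 + A * \<bar>r\<bar> powr ((real n - 2) / 2)) -` (- {0}) = psi_dom n A"
    by (auto simp: psi_dom_def)
  finally show ?thesis .
qed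

lemma psi_dom_neg:
  assumes "n \<ge> 3" "A < 0"
  shows "psi_dom n A = {r. r \<noteq> 0 \<and> \<bar>r\<bar> \<noteq> (sing_radius n A)\<^sup>2}" "sing_radius n A > 0"
proof -
  define m where "m = (real n - 2) / 2"
  have m: "m > 0" using assms by (simp add: m_def)
  have e: "2 / (real n - 2) = 1 / m" unfolding m_def by simp
  have R: "(sing_radius n A)\<^sup>2 = (- 1 / A) powr (1 / m)"
    using assms(2) by (simp add: sing_radius_def e)
  have "1 + A * \<bar>r\<bar> powr m = 0 \<longleftrightarrow> \<bar>r\<bar> = (- 1 / A) powr (1 / m)" if "r \<noteq> 0" for r
  proof -
    have "1 + A * \<bar>r\<bar> powr m = 0 \<longleftrightarrow> \<bar>r\<bar> powr m = - 1 / A" using assms(2) by (auto simp: field_simps)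
    also have "\<dots> \<longleftrightarrow> \<bar>r\<bar> powr m = ((- 1 / A) powr (1 / m)) powr m"
      using m assms(2) by (simp add: powr_powr)
    \<comment> \<open>A positive power is strictly increasing on the nonnegative reals, hence
      injective.\<close>
    also have "\<dots> \<longleftrightarrow> \<bar>r\<bar> = (- 1 / A) powr (1 / m)"
      using powr_less_mono2[OF m]
      by (metis abs_ge_zero less_irrefl linorder_neqE_linordered_idom powr_ge_zero)
    finally show ?thesis .
  qed
  then show "psi_dom n A = {r. r \<noteq> 0 \<and> \<bar>r\<bar> \<noteq> (sing_radius n A)\<^sup>2}"
    unfolding psi_dom_def R m_def[symmetric] by auto
  show "sing_radius n A > 0" using assms(2) by (simp add: sing_radius_def)
qed

text \<open>Provides approach to a singular point through regular ones. Along a coordinate line r is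
  a quadratic polynomial with leading coefficient \<epsilon> i, so it takes the value at x for at
  most two parameters.\<close>

lemma pe_r_approach:
  fixes \<epsilon> :: "'n::finite \<Rightarrow> real"
  assumes eps: "\<And>i. \<epsilon> i = 1 \<or> \<epsilon> i = - 1"
  obtains \<gamma> :: "real \<Rightarrow> real^'n" where "(\<gamma> \<longlongrightarrow> x) (at 0)"
    "((\<lambda>t. pe_r \<epsilon> (\<gamma> t)) \<longlongrightarrow> pe_r \<epsilon> x) (at 0)"
    "\<forall>\<^sub>F t in at 0. pe_r \<epsilon> (\<gamma> t) \<noteq> pe_r \<epsilon> x"
proof -
  obtain i :: 'n where True by blast
  define \<gamma> where "\<gamma> t = x + t *\<^sub>R axis i 1" for t :: real
  have g: "(\<gamma> \<longlongrightarrow> x) (at 0)"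
    unfolding \<gamma>_def[abs_def] by (auto intro!: tendsto_eq_intros)
  have "isCont (pe_r \<epsilon>) x" using continuous_pe_r[of UNIV \<epsilon>] by (simp add: continuous_on_eq_continuous_at)
  then have 2: "((\<lambda>t. pe_r \<epsilon> (\<gamma> t)) \<longlongrightarrow> pe_r \<epsilon> x) (at 0)"
    using g by (rule isCont_tendsto_compose)
  have "pe_r \<epsilon> (\<gamma> t) - pe_r \<epsilon> x = \<epsilon> i * (t * (2 * x $ i + t))" for t
  proof -
    have "pe_r \<epsilon> (\<gamma> t) - pe_r \<epsilon> x = (\<Sum>k\<in>UNIV. if k = i then \<epsilon> i * (t * (2 * x $ i + t)) else 0)"
      unfolding pe_r_def sum_subtractf[symmetric]
      by (rule sum.cong) (auto simp: \<gamma>_def axis_def power2_eq_square algebra_simps)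
    then show ?thesis by simp
  qed
  moreover have "\<epsilon> i \<noteq> 0" using eps[of i] by auto
  ultimately have ne: "pe_r \<epsilon> (\<gamma> t) \<noteq> pe_r \<epsilon> x" if "t \<noteq> 0" "t \<noteq> - 2 * x $ i" for t
    using that by (metis add.commute eq_iff_diff_eq_0 minus_mult_left mult_eq_0_iff neg_eq_iff_add_eq_0 add_eq_0_iff)
  have "\<forall>\<^sub>F t in at 0. t \<noteq> - 2 * x $ i"
  proof (cases "x $ i = 0")
    case True
    then show ?thesis by (simp add: eventually_at_filter)
  next
    case False
    then show ?thesis by (intro tendsto_imp_eventually_ne[OF tendsto_ident_at]) simp
  qed
  moreover have "\<forall>\<^sub>F t in at 0. t \<noteq> (0::real)" by (simp add: eventually_at_filter)
  ultimately have "\<forall>\<^sub>F t in at 0. pe_r \<epsilon> (\<gamma> t) \<noteq> pe_r \<epsilon> x"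
    by eventually_elim (use ne in auto)
  with g 2 show ?thesis using that by blast
qed

lemma singularity_points_conf_psi_sol:
  fixes \<epsilon> :: "'n::finite \<Rightarrow> real"
  assumes n: "CARD('n) \<ge> 3" and eps: "\<And>i. \<epsilon> i = 1 \<or> \<epsilon> i = - 1" and k: "k > 0" and A: "A < 0"
  shows "singularity_points (pe_r \<epsilon> -` psi_dom CARD('n) A) (conf_metric \<epsilon> (psi_sol CARD('n) A k))
          = {x. pe_r \<epsilon> x = 0} \<union> {x. \<bar>pe_r \<epsilon> x\<bar> = (sing_radius CARD('n) A)\<^sup>2}"
proof -
  define D where "D = pe_r \<epsilon> -` psi_dom CARD('n) A"
  define m where "m = (real CARD('n) - 2) / 2"
  have m: "m > 0" using n by (simp add: m_def)
  have e: "2 / (real CARD('n) - 2) = 1 / m" unfolding m_def by simp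
  define \<psi> where "\<psi> = psi_sol CARD('n) A k"
  have \<psi>: "\<psi> r = k * \<bar>r\<bar> / \<bar>1 + A * \<bar>r\<bar> powr m\<bar> powr (1 / m)" for r
    by (simp add: \<psi>_def psi_sol_def m_def[symmetric] e)
  have R: "sing_radius CARD('n) A > 0" using psi_dom_neg[OF n A] by simp
  have D_eq: "D = {x. pe_r \<epsilon> x \<noteq> 0 \<and> \<bar>pe_r \<epsilon> x\<bar> \<noteq> (sing_radius CARD('n) A)\<^sup>2}"
    unfolding D_def psi_dom_neg[OF n A] by auto
  have D1: "pe_r \<epsilon> y \<noteq> 0" "1 + A * \<bar>pe_r \<epsilon> y\<bar> powr m \<noteq> 0" if "y \<in> D" for y
    using that by (auto simp: D_def psi_dom_def m_def)
  have oD: "open D" unfolding D_def by (intro open_pe_r_vimage open_psi_dom)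
  have "x \<notin> singularity_points D (conf_metric \<epsilon> \<psi>)" if "x \<in> D" for x
    using that pseudo_metric_on_conf_psi_sol[where \<epsilon> = \<epsilon>, OF eps oD _ k, of A] unfolding singularity_points_def \<psi>_def D_def
    by auto
  moreover have "x \<in> singularity_points D (conf_metric \<epsilon> \<psi>)" if x: "x \<notin> D" for x
  proof (rule ccontr)
    assume "x \<notin> singularity_points D (conf_metric \<epsilon> \<psi>)"
    then obtain U h where U: "x \<in> U" "pseudo_metric_on U h" "\<And>y. y \<in> U \<inter> D \<Longrightarrow> h y = conf_metric \<epsilon> \<psi> y"
      unfolding singularity_points_def by auto
    have oU: "open U" and "det (h x) \<noteq> 0" and "\<And>i j. Ck_on 0 U (\<lambda>x. h x $ i $ j)"
      using U(1,2) unfolding pseudo_metric_on_def smooth_on_def by blast+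
    then have hc: "isCont (\<lambda>x. h x $ i $ j) x" for i j
      using U(1) by (simp add: continuous_on_eq_continuous_at)
    obtain \<gamma> where \<gamma>: "(\<gamma> \<longlongrightarrow> x) (at (0::real))"
      "((\<lambda>t. pe_r \<epsilon> (\<gamma> t)) \<longlongrightarrow> pe_r \<epsilon> x) (at 0)"
      "\<forall>\<^sub>F t in at 0. pe_r \<epsilon> (\<gamma> t) \<noteq> pe_r \<epsilon> x"
      using pe_r_approach[where \<epsilon> = \<epsilon>, OF eps] by metis
    have "\<forall>\<^sub>F t in at 0. \<gamma> t \<in> U" using \<gamma>(1) oU U(1) by (rule topological_tendstoD)
    moreover have "\<forall>\<^sub>F t in at 0. \<gamma> t \<in> D"
    proof -
      \<comment> \<open>The forbidden values of r other than the one at x form a closed set avoiding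
        \<open>pe_r \<epsilon> x\<close>, so continuity keeps the curve off them. The value at x
        itself is avoided by the choice of the curve.\<close>
      let ?B = "{0, (sing_radius CARD('n) A)\<^sup>2, - (sing_radius CARD('n) A)\<^sup>2} - {pe_r \<epsilon> x}"
      have "open (- ?B)" by (intro open_Compl finite_imp_closed) auto
      then have "\<forall>\<^sub>F t in at 0. pe_r \<epsilon> (\<gamma> t) \<in> - ?B" by (rule topological_tendstoD[OF \<gamma>(2)]) auto
      with \<gamma>(3) show ?thesis by eventually_elim (auto simp: D_eq)
    qed
    ultimately have UD: "\<forall>\<^sub>F t in at 0. \<gamma> t \<in> U \<inter> D" by eventually_elim auto
    have hl: "((\<lambda>t. h (\<gamma> t) $ i $ j) \<longlongrightarrow> h x $ i $ j) (at 0)" for i j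
      using isCont_tendsto_compose[OF hc \<gamma>(1)] .
    define w where "w t = \<bar>1 + A * \<bar>pe_r \<epsilon> (\<gamma> t)\<bar> powr m\<bar> powr (1 / m)" for t
    \<comment> \<open>The bases may tend to 0; positivity of the exponents m and 1/m makes the
      powers continuous there.\<close>
    have "((\<lambda>t. 1 + A * \<bar>pe_r \<epsilon> (\<gamma> t)\<bar> powr m) \<longlongrightarrow> 1 + A * \<bar>pe_r \<epsilon> x\<bar> powr m) (at 0)"
      using m by (intro tendsto_intros \<gamma>(2) tendsto_powr' ) auto
    then have wl: "(w \<longlongrightarrow> \<bar>1 + A * \<bar>pe_r \<epsilon> x\<bar> powr m\<bar> powr (1 / m)) (at 0)"
      unfolding w_def[abs_def] using m by (intro tendsto_powr' tendsto_rabs tendsto_const) auto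
    \<comment> \<open>Clearing the denominator of the metric gives an identity whose two sides have
      finite limits, so it persists at x.\<close>
    have hw: "\<forall>\<^sub>F t in at 0. k\<^sup>2 * (pe_r \<epsilon> (\<gamma> t))\<^sup>2 * h (\<gamma> t) $ i $ j = (if i = j then \<epsilon> i * (w t)\<^sup>2 else 0)" for i j
      using UD
    proof eventually_elim
      case (elim t)
      then show ?case
        using D1[of "\<gamma> t"] k
        by (simp add: U(3) conf_metric_nth \<psi> w_def power_divide power_mult_distrib)
    qed
    have lim: "k\<^sup>2 * (pe_r \<epsilon> x)\<^sup>2 * h x $ i $ j
        = (if i = j then \<epsilon> i * (\<bar>1 + A * \<bar>pe_r \<epsilon> x\<bar> powr m\<bar> powr (1 / m))\<^sup>2 else 0)" for i j
    proof (rule tendsto_unique)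
      show "((\<lambda>t. k\<^sup>2 * (pe_r \<epsilon> (\<gamma> t))\<^sup>2 * h (\<gamma> t) $ i $ j) \<longlongrightarrow> k\<^sup>2 * (pe_r \<epsilon> x)\<^sup>2 * h x $ i $ j) (at 0)"
        by (intro tendsto_intros \<gamma>(2) hl)
      show "((\<lambda>t. k\<^sup>2 * (pe_r \<epsilon> (\<gamma> t))\<^sup>2 * h (\<gamma> t) $ i $ j) \<longlongrightarrow>
         (if i = j then \<epsilon> i * (\<bar>1 + A * \<bar>pe_r \<epsilon> x\<bar> powr m\<bar> powr (1 / m))\<^sup>2 else 0)) (at 0)"
        unfolding tendsto_cong[OF hw] by (auto intro!: tendsto_intros wl)
    qed simp
    show False
    proof (cases "pe_r \<epsilon> x = 0")
      case True
      fix i :: 'n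
      \<comment> \<open>At r = 0 a diagonal entry of the identity reads 0 = \<epsilon> i.\<close>
      show False using lim[of i i] True eps[of i] m by auto
    next
      case False
      then have "1 + A * \<bar>pe_r \<epsilon> x\<bar> powr m = 0"
        using x by (auto simp: D_def psi_dom_def m_def)
      then have "h x $ i $ j = 0" for i j using lim[of i j] False k by (auto split: if_splits)
      then have "det (h x) = 0" by (simp add: det_diagonal)
      then show False using \<open>det (h x) \<noteq> 0\<close> by contradiction
    qed
  qed
  ultimately have "singularity_points D (conf_metric \<epsilon> \<psi>) = - D" by blast
  then show ?thesis unfolding D_def[symmetric] \<psi>_def[symmetric] by (auto simp: D_eq)
qed

text \<open>With equal signs r is plus or minus the squared norm, so the level sets of |r| become
  the origin and round spheres.\<close>

lemma pe_r_definite: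
  fixes \<epsilon> :: "'n::finite \<Rightarrow> real"
  assumes "\<And>i. \<epsilon> i = 1 \<or> \<epsilon> i = - 1" "\<forall>i j. \<epsilon> i = \<epsilon> j"
  shows "\<bar>pe_r \<epsilon> x\<bar> = (norm x)\<^sup>2"
proof -
  obtain c where c: "\<epsilon> = (\<lambda>_. c)" "c = 1 \<or> c = - 1" using assms by fastforce
  have "pe_r \<epsilon> x = c * (norm x)\<^sup>2"
    by (simp add: pe_r_def c(1) norm_vec_def L2_set_def sum_nonneg flip: sum_distrib_left)
  then show ?thesis using c(2) by auto
qed

text \<open>A constant \<psi> also gives a flat metric but is outside the family, hence the
  nonconstancy assumption. For mixed signs r = 0 is a cone rather than a point, so regular and
  singular sets are described by level sets of r in general, and by the origin and a sphere in the
  definite case.\<close>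

theorem theorem1p4:
  fixes \<epsilon> :: "'n::finite \<Rightarrow> real"
  assumes "CARD('n) \<ge> 3"
    and "\<And>i. \<epsilon> i = 1 \<or> \<epsilon> i = - 1"
  shows
    "(\<forall>(J :: real set) (\<psi> :: real \<Rightarrow> real).
        open J \<and> connected J \<and> J \<subseteq> range (pe_r \<epsilon>) \<and>
        smooth_on J \<psi> \<and> (\<forall>r\<in>J. \<psi> r > 0) \<and> \<not> \<psi> constant_on J \<longrightarrow>
        ((\<forall>x. pe_r \<epsilon> x \<in> J \<longrightarrow> scalar_curvature (conf_metric \<epsilon> \<psi>) x = 0) \<longleftrightarrow>
         (\<exists>A k\<^sub>2. k\<^sub>2 > 0 \<and> (\<forall>r\<in>J. \<psi> r = psi_sol CARD('n) A k\<^sub>2 r))))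
     \<and>
     (\<forall>A k\<^sub>2. k\<^sub>2 > 0 \<and> A \<ge> 0 \<longrightarrow>
        pseudo_metric_on {x. pe_r \<epsilon> x \<noteq> 0} (conf_metric \<epsilon> (psi_sol CARD('n) A k\<^sub>2)) \<and>
        ((\<forall>i j. \<epsilon> i = \<epsilon> j) \<longrightarrow>
          pseudo_metric_on (UNIV - {0}) (conf_metric \<epsilon> (psi_sol CARD('n) A k\<^sub>2))))
     \<and>
     (\<forall>A k\<^sub>2. k\<^sub>2 > 0 \<and> A < 0 \<longrightarrow>
        singularity_points (pe_r \<epsilon> -` psi_dom CARD('n) A) (conf_metric \<epsilon> (psi_sol CARD('n) A k\<^sub>2))
          = {x. pe_r \<epsilon> x = 0} \<union> {x. \<bar>pe_r \<epsilon> x\<bar> = (sing_radius CARD('n) A)\<^sup>2} \<and>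
        ((\<forall>i j. \<epsilon> i = \<epsilon> j) \<longrightarrow>
          singularity_points (pe_r \<epsilon> -` psi_dom CARD('n) A) (conf_metric \<epsilon> (psi_sol CARD('n) A k\<^sub>2))
            = {0} \<union> sphere 0 (sing_radius CARD('n) A)))"
proof (intro conjI allI impI; elim conjE)
  fix J :: "real set" and \<psi> :: "real \<Rightarrow> real"
  assume "open J" "connected J" "J \<subseteq> range (pe_r \<epsilon>)" "smooth_on J \<psi>" "\<forall>r\<in>J. \<psi> r > 0"
    "\<not> \<psi> constant_on J"
  then show "(\<forall>x. pe_r \<epsilon> x \<in> J \<longrightarrow> scalar_curvature (conf_metric \<epsilon> \<psi>) x = 0) \<longleftrightarrow>
         (\<exists>A k\<^sub>2. k\<^sub>2 > 0 \<and> (\<forall>r\<in>J. \<psi> r = psi_sol CARD('n) A k\<^sub>2 r))"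
    using scalar_flat_conf_metric_iff[where \<epsilon> = \<epsilon>, OF assms, of J \<psi>] by blast
next
  fix A k\<^sub>2 :: real
  assume k: "k\<^sub>2 > 0" and A: "A \<ge> 0"
  have "{x. pe_r \<epsilon> x \<noteq> 0} = pe_r \<epsilon> -` (- {0})" by auto
  then have o: "open {x. pe_r \<epsilon> x \<noteq> 0}" by (simp add: open_pe_r_vimage open_Compl)
  have "1 + A * \<bar>r\<bar> powr ((real CARD('n) - 2) / 2) \<noteq> 0" for r
  proof -
    have "A * \<bar>r\<bar> powr ((real CARD('n) - 2) / 2) \<ge> 0" using A by simp
    then show ?thesis by linarith
  qed
  then have "{x. pe_r \<epsilon> x \<noteq> 0} \<subseteq> pe_r \<epsilon> -` psi_dom CARD('n) A" by (auto simp: psi_dom_def)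
  from pseudo_metric_on_conf_psi_sol[where \<epsilon> = \<epsilon>, OF assms(2) o this k]
  show *: "pseudo_metric_on {x. pe_r \<epsilon> x \<noteq> 0} (conf_metric \<epsilon> (psi_sol CARD('n) A k\<^sub>2))" .
  assume "\<forall>i j. \<epsilon> i = \<epsilon> j"
  then have "pe_r \<epsilon> x = 0 \<longleftrightarrow> x = 0" for x
    using pe_r_definite[where \<epsilon> = \<epsilon>, OF assms(2), of x] by (metis abs_eq_0 norm_eq_zero power2_eq_iff_nonneg power_zero_numeral zero_eq_power2)
  then have "UNIV - {0} = {x. pe_r \<epsilon> x \<noteq> 0}" by auto
  with * show "pseudo_metric_on (UNIV - {0}) (conf_metric \<epsilon> (psi_sol CARD('n) A k\<^sub>2))" by simp
next
  fix A k\<^sub>2 :: real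
  assume k: "k\<^sub>2 > 0" and A: "A < 0"
  show *: "singularity_points (pe_r \<epsilon> -` psi_dom CARD('n) A) (conf_metric \<epsilon> (psi_sol CARD('n) A k\<^sub>2))
          = {x. pe_r \<epsilon> x = 0} \<union> {x. \<bar>pe_r \<epsilon> x\<bar> = (sing_radius CARD('n) A)\<^sup>2}"
    using singularity_points_conf_psi_sol[where \<epsilon> = \<epsilon>, OF assms k A] .
  assume "\<forall>i j. \<epsilon> i = \<epsilon> j"
  then have r: "\<bar>pe_r \<epsilon> x\<bar> = (norm x)\<^sup>2" for x using pe_r_definite[where \<epsilon> = \<epsilon>, OF assms(2)] by blast
  then have "pe_r \<epsilon> x = 0 \<longleftrightarrow> x = 0" for x
    by (metis abs_eq_0 norm_eq_zero zero_eq_power2)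
  moreover have "\<bar>pe_r \<epsilon> x\<bar> = (sing_radius CARD('n) A)\<^sup>2 \<longleftrightarrow> norm x = sing_radius CARD('n) A" for x
    using psi_dom_neg(2)[OF assms(1) A] by (simp add: r power2_eq_iff_nonneg)
  ultimately show "singularity_points (pe_r \<epsilon> -` psi_dom CARD('n) A) (conf_metric \<epsilon> (psi_sol CARD('n) A k\<^sub>2))
            = {0} \<union> sphere 0 (sing_radius CARD('n) A)"
    unfolding * by auto
qed

end
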